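(* Consider the polynomial optimization problem $$\min_{x\in\mathbb{R}^n}\ \sum_{i=1}^s f_i(x^{(i)})\quad \text{s.t.}\quad g^{(i)}(x^{(i)})\ge 0,\ h^{(i)}(x^{(i)})=0\quad (i=1,\dots,s)\qquad (P)$$ with correlative sparsity pattern $(\mathcal{I}_1,\dots,\mathcal{I}_s)$ as in the context. Assume that for each $i\in[s]$ there are polynomial matrices $L^{(i)}\in\mathbb{R}[x^{(i)}]^{\hat m_i\times n_i}$ and $D^{(i)}\in\mathbb{R}[x^{(i)}]^{\hat m_i\times\hat m_i}$, $\hat m_i=m_i+\ell_i$, with $$\big[\,L^{(i)}(x^{(i)})\ \ D^{(i)}(x^{(i)})\,\big]\,G^{(i)}(x^{(i)})=I_{\hat m_i},$$ where $G^{(i)}$ is the matrix defined in the context. Let $z^{(i)}=(x^{(i)},(\nu_\gamma)_{\gamma\in\mathcal{J}_i})$, $F^{(i)}(z^{(i)})=\nabla_i f_i(x^{(i)})+\nu^{(i)}$ and $$p^{(i)}(z^{(i)})=L^{(i)}(x^{(i)})\,F^{(i)}(z^{(i)}).$$ Then $x\in\mathbb{R}^n$ is a KKT point of $(P)$ if and only if there exist real numbers $\{\nu_{i,t,k}:(i,t)\in A,\ k\in\mathcal{C}_{i,t}\}$ such that for every $i\in[s]$, $$F^{(i)}(z^{(i)})=\sum_{j=1}^{m_i}p^{(i)}_j(z^{(i)})\nabla_i g^{(i)}_j(x^{(i)})+\sum_{j=1}^{\ell_i}p^{(i)}_{m_i+j}(z^{(i)})\nabla_i h^{(i)}_j(x^{(i)}),$$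 $$0\le p^{(i)}_{1:m_i}(z^{(i)})\perp g^{(i)}(x^{(i)})\ge0,\qquad h^{(i)}(x^{(i)})=0 .$$
   Context: Setting. $[n]=\{1,\dots,n\}$; $\mathcal{I}_1,\dots,\mathcal{I}_s\subseteq[n]$ with $\bigcup_i\mathcal{I}_i=[n]$, each with a fixed ordering of its elements; $n_i=|\mathcal{I}_i|$; $x^{(i)}=(x_k)_{k\in\mathcal{I}_i}$. For each $i\in[s]$, $f_i\in\mathbb{R}[x^{(i)}]$, $g^{(i)}$ is a tuple of $m_i\ge 0$ polynomials in $\mathbb{R}[x^{(i)}]$ and $h^{(i)}$ is a tuple of $\ell_i\ge 0$ polynomials in $\mathbb{R}[x^{(i)}]$. Standing assumptions on the pattern: (a) running intersection property (RIP): for every $i\in[s-1]$ there is $t\le i$ with $\mathcal{I}_{i+1}\cap\bigcup_{j=1}^i\mathcal{I}_j\subseteq\mathcal{I}_t$; (b) $\mathcal{I}_i\not\subseteq\mathcal{I}_j$ for distinct $i,j\in[s]$; (c) $\mathcal{I}_{i+1}\cap\bigcup_{j=1}^i\mathcal{I}_j\ne\emptyset$ for all $i\in[s-1]$. Notation. $\nabla$ is the gradient in $\mathbb{R}^n$; $\nabla_i p\in\mathbb{R}[x]^{n_i}$ is the vector of partial derivatives of $p$ with respect to the entries of $x^{(i)}$. For $k\in\mathcal{I}_i$, $e^{(i)}_k\in\mathbb{R}^{n_i}$ is the standard basis vector whose nonzero entry is at the position of $k$ in the ordered tuple $\mathcal{I}_i$. $v_{1:m}$ is the subvector of the first $m$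 entries; $v\perp w$ means $v^\top w=0$; vector inequalities are entrywise. KKT point. $x$ is a KKT point of $(P)$ if there are $\lambda^{(i)}\in\mathbb{R}^{m_i+\ell_i}$, $i\in[s]$, with $$\sum_{i=1}^s\nabla f_i(x)=\sum_{i=1}^s\Big(\sum_{j=1}^{m_i}\lambda^{(i)}_j\nabla g^{(i)}_j(x)+\sum_{j=1}^{\ell_i}\lambda^{(i)}_{m_i+j}\nabla h^{(i)}_j(x)\Big)$$ and, for all $i\in[s]$, $h^{(i)}(x)=0$ and $0\le\lambda^{(i)}_{1:m_i}\perp g^{(i)}(x)\ge0$. The matrix $G^{(i)}$. With $c^{(i)}=(g^{(i)},h^{(i)})=(c^{(i)}_1,\dots,c^{(i)}_{\hat m_i})$, $G^{(i)}(x^{(i)})$ is the $(n_i+\hat m_i)\times\hat m_i$ polynomial matrix whose first $n_i$ rows form $[\nabla_i c^{(i)}_1\ \cdots\ \nabla_i c^{(i)}_{\hat m_i}]$ and whose last $\hat m_i$ rows form $\mathrm{diag}(c^{(i)}_1,\dots,c^{(i)}_{\hat m_i})$. $I_r$ is the $r\times r$ identity matrix. Directed clique tree. $A$ is the set of arcs on the node set $[s]$ consisting of the pairs $(i+1,t)$, $i=1,\dots,s-1$, where $t$ is the largest index $t\le i$ with $\mathcal{I}_{i+1}\cap\bigcup_{j=1}^i\mathcal{I}_j\subseteq\mathcal{I}_t$. Put $\mathcal{D}_i=\{t:(t,i)\in A\}$, $\mathcal{A}_i=\{t:(i,t)\in A\}$, $\mathcal{C}_{i,t}=\mathcal{I}_i\cap\mathcal{I}_t$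 for $(i,t)\in A$. Auxiliary variables are $\nu_{i,t,k}$ for $(i,t)\in A$, $k\in\mathcal{C}_{i,t}$. Put $\mathcal{J}_i=\{(i,t,k):t\in\mathcal{A}_i,k\in\mathcal{C}_{i,t}\}\cup\{(t,i,k):t\in\mathcal{D}_i,k\in\mathcal{C}_{t,i}\}$ and $$\nu^{(i)}=-\sum_{t\in\mathcal{A}_i}\sum_{k\in\mathcal{C}_{i,t}}\nu_{i,t,k}e^{(i)}_k+\sum_{t\in\mathcal{D}_i}\sum_{k\in\mathcal{C}_{t,i}}\nu_{t,i,k}e^{(i)}_k\in\mathbb{R}^{n_i}.$$ *)

theory Defs
  imports Complex_Main "HOL-Library.Poly_Mapping" "Jordan_Normal_Form.Matrix"
begin

text \<open>
  All index sets are 0-based: the variables are \<open>x\<^sub>0, \<dots>, x\<^sub>n\<^sub>-\<^sub>1\<close>, the cliques are numbered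
  \<open>0, \<dots>, s - 1\<close>, and entries of tuples, vectors and matrices start at position 0.
\<close>

section \<open>Multivariate polynomials over the reals\<close>

text \<open>A monomial maps each variable to its exponent, a polynomial maps each monomial to its
  coefficient; the ring structure (convolution product) is the one of \<open>Poly_Mapping\<close>.\<close>

type_synonym rpoly = "(nat \<Rightarrow>\<^sub>0 nat) \<Rightarrow>\<^sub>0 real"

definition poly_vars :: "rpoly \<Rightarrow> nat set" where
  "poly_vars p = (\<Union>m\<in>Poly_Mapping.keys p. Poly_Mapping.keys m)"

text \<open>The subring \<open>\<real>[x\<^sub>k : k \<in> V]\<close>.\<close>

definition polys_in :: "nat set \<Rightarrow> rpoly set" where
  "polys_in V = {p. poly_vars p \<subseteq> V}"

definition monom_eval :: "real vec \<Rightarrow> (nat \<Rightarrow>\<^sub>0 nat) \<Rightarrow> real" where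
  "monom_eval x m = (\<Prod>k\<in>Poly_Mapping.keys m. (x $ k) ^ Poly_Mapping.lookup m k)"

definition peval :: "real vec \<Rightarrow> rpoly \<Rightarrow> real" where
  "peval x p = (\<Sum>m\<in>Poly_Mapping.keys p. Poly_Mapping.lookup p m * monom_eval x m)"

text \<open>Formal partial derivative with respect to \<open>x\<^sub>k\<close>. Subtraction of exponents is truncated, but a
  monomial that does not contain \<open>x\<^sub>k\<close> gets the coefficient 0.\<close>

definition partial_deriv :: "nat \<Rightarrow> rpoly \<Rightarrow> rpoly" where
  "partial_deriv k p =
     (\<Sum>m\<in>Poly_Mapping.keys p.
        Poly_Mapping.single (m - Poly_Mapping.single k 1)
          (real (Poly_Mapping.lookup m k) * Poly_Mapping.lookup p m))"

definition gradient :: "nat \<Rightarrow> rpoly \<Rightarrow> real vec \<Rightarrow> real vec" where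
  "gradient n p x = vec n (\<lambda>k. peval x (partial_deriv k p))"

text \<open>\<open>\<nabla>\<^sub>i p\<close> as a vector of polynomials, where the list \<open>K\<close> is the ordered clique \<open>\<I>\<^sub>i\<close>.\<close>

definition clique_gradient :: "nat list \<Rightarrow> rpoly \<Rightarrow> rpoly vec" where
  "clique_gradient K p = vec (length K) (\<lambda>j. partial_deriv (K ! j) p)"

abbreviation eval_vec :: "real vec \<Rightarrow> rpoly vec \<Rightarrow> real vec" where
  "eval_vec x \<equiv> map_vec (peval x)"

abbreviation eval_mat :: "real vec \<Rightarrow> rpoly mat \<Rightarrow> real mat" where
  "eval_mat x \<equiv> map_mat (peval x)"

definition eval_tuple :: "real vec \<Rightarrow> rpoly list \<Rightarrow> real vec" where
  "eval_tuple x c = vec (length c) (\<lambda>j. peval x (c ! j))"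

text \<open>The formal partial derivative is the analytic one.\<close>

lemma monom_eval_superset:
  assumes "finite S" "Poly_Mapping.keys m \<subseteq> S"
  shows "monom_eval x m = (\<Prod>k\<in>S. (x $ k) ^ Poly_Mapping.lookup m k)"
  unfolding monom_eval_def
  by (rule prod.mono_neutral_left) (use assms in \<open>auto simp: in_keys_iff\<close>)

lemma peval_superset:
  assumes "finite S" "Poly_Mapping.keys p \<subseteq> S"
  shows "peval x p = (\<Sum>m\<in>S. Poly_Mapping.lookup p m * monom_eval x m)"
  unfolding peval_def
  by (rule sum.mono_neutral_left) (use assms in \<open>auto simp: in_keys_iff\<close>)

lemma peval_zero [simp]: "peval x 0 = 0"
  by (simp add: peval_def)

lemma peval_single [simp]: "peval x (Poly_Mapping.single m c) = c * monom_eval x m"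
  by (subst peval_superset[of "{m}"]) auto

lemma peval_add: "peval x (p + q) = peval x p + peval x q"
proof -
  let ?S = "Poly_Mapping.keys p \<union> Poly_Mapping.keys q"
  have "peval x r = (\<Sum>m\<in>?S. Poly_Mapping.lookup r m * monom_eval x m)"
    if "r \<in> {p, q, p + q}" for r
    by (rule peval_superset) (use that Poly_Mapping.keys_add[of p q] in auto)
  then show ?thesis
    by (simp add: lookup_add distrib_right sum.distrib)
qed

lemma peval_sum: "peval x (sum f A) = (\<Sum>a\<in>A. peval x (f a))"
  by (induction A rule: infinite_finite_induct) (simp_all add: peval_add)

lemma monom_eval_has_partial_deriv:
  assumes m: "Poly_Mapping.keys m \<subseteq> {..<n}" and k: "k < n" and x: "x \<in> carrier_vec n"
  shows "((\<lambda>t. monom_eval (vec n (\<lambda>j. if j = k then t else x $ j)) m) has_real_derivative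
           real (Poly_Mapping.lookup m k) * monom_eval x (m - Poly_Mapping.single k 1))
         (at (x $ k))"
proof -
  let ?R = "\<Prod>j\<in>{..<n} - {k}. (x $ j) ^ Poly_Mapping.lookup m j"
  have split: "(\<Prod>j\<in>{..<n}. u j) = u k * (\<Prod>j\<in>{..<n} - {k}. u j)" for u :: "nat \<Rightarrow> real"
    using k by (intro prod.remove) auto
  have 1: "monom_eval (vec n (\<lambda>j. if j = k then t else x $ j)) m
           = t ^ Poly_Mapping.lookup m k * ?R" for t
    by (subst monom_eval_superset[of "{..<n}"], use m in simp_all)
       (subst split, use k in \<open>auto intro!: prod.cong\<close>)
  have keys: "Poly_Mapping.keys (m - Poly_Mapping.single k 1) \<subseteq> {..<n}"
    using m by (auto simp: in_keys_iff lookup_minus subset_iff)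
  have 2: "monom_eval x (m - Poly_Mapping.single k 1)
           = (x $ k) ^ (Poly_Mapping.lookup m k - 1) * ?R"
    by (subst monom_eval_superset[of "{..<n}"], use keys in simp_all)
       (subst split, auto simp: lookup_minus lookup_single when_def intro!: prod.cong)
  show ?thesis
    unfolding 1 2 by (auto intro!: derivative_eq_intros)
qed

lemma peval_has_partial_deriv:
  assumes p: "p \<in> polys_in {..<n}" and k: "k < n" and x: "x \<in> carrier_vec n"
  shows "((\<lambda>t. peval (vec n (\<lambda>j. if j = k then t else x $ j)) p) has_real_derivative
           peval x (partial_deriv k p)) (at (x $ k))"
proof -
  have "Poly_Mapping.keys m \<subseteq> {..<n}" if "m \<in> Poly_Mapping.keys p" for m
    using p that by (auto simp: polys_in_def poly_vars_def)
  then have "((\<lambda>t. \<Sum>m\<in>Poly_Mapping.keys p. Poly_Mapping.lookup p m *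
                monom_eval (vec n (\<lambda>j. if j = k then t else x $ j)) m) has_real_derivative
     (\<Sum>m\<in>Poly_Mapping.keys p. Poly_Mapping.lookup p m *
        (real (Poly_Mapping.lookup m k) * monom_eval x (m - Poly_Mapping.single k 1))))
     (at (x $ k))"
    by (intro DERIV_sum DERIV_cmult monom_eval_has_partial_deriv k x) auto
  then show ?thesis
    by (simp add: peval_def[of "vec n _"] partial_deriv_def peval_sum mult_ac)
qed

section \<open>The correlative sparsity pattern\<close>

text \<open>The running intersection \<open>\<I>\<^sub>i\<^sub>+\<^sub>1 \<inter> (\<I>\<^sub>0 \<union> \<dots> \<union> \<I>\<^sub>i)\<close>. A clique is a list without repetitions,
  which fixes the ordering of its elements.\<close>

definition run_inter :: "(nat \<Rightarrow> nat list) \<Rightarrow> nat \<Rightarrow> nat set" where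
  "run_inter I i = set (I (Suc i)) \<inter> (\<Union>j\<le>i. set (I j))"

definition sparsity_pattern :: "nat \<Rightarrow> nat \<Rightarrow> (nat \<Rightarrow> nat list) \<Rightarrow> bool" where
  "sparsity_pattern n s I \<longleftrightarrow>
     (\<forall>i<s. distinct (I i)) \<and>
     (\<Union>i<s. set (I i)) = {..<n} \<and>
     (\<forall>i. Suc i < s \<longrightarrow> (\<exists>t\<le>i. run_inter I i \<subseteq> set (I t))) \<and>
     (\<forall>i<s. \<forall>j<s. i \<noteq> j \<longrightarrow> \<not> set (I i) \<subseteq> set (I j)) \<and>
     (\<forall>i. Suc i < s \<longrightarrow> run_inter I i \<noteq> {})"

definition clique_arcs :: "nat \<Rightarrow> (nat \<Rightarrow> nat list) \<Rightarrow> (nat \<times> nat) set" where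
  "clique_arcs s I = {(Suc i, Max {t. t \<le> i \<and> run_inter I i \<subseteq> set (I t)}) | i. Suc i < s}"

definition clique_in :: "nat \<Rightarrow> (nat \<Rightarrow> nat list) \<Rightarrow> nat \<Rightarrow> nat set" where
  "clique_in s I i = {t. (t, i) \<in> clique_arcs s I}"

definition clique_out :: "nat \<Rightarrow> (nat \<Rightarrow> nat list) \<Rightarrow> nat \<Rightarrow> nat set" where
  "clique_out s I i = {t. (i, t) \<in> clique_arcs s I}"

definition clique_sep :: "(nat \<Rightarrow> nat list) \<Rightarrow> nat \<Rightarrow> nat \<Rightarrow> nat set" where
  "clique_sep I i t = set (I i) \<inter> set (I t)"

section \<open>KKT points\<close>

abbreviation vsum :: "nat \<Rightarrow> ('b \<Rightarrow> real vec) \<Rightarrow> 'b set \<Rightarrow> real vec" where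
  "vsum n v S \<equiv> finsum_vec TYPE(real) n v S"

definition kkt_point ::
  "nat \<Rightarrow> nat \<Rightarrow> (nat \<Rightarrow> rpoly) \<Rightarrow> (nat \<Rightarrow> rpoly list) \<Rightarrow> (nat \<Rightarrow> rpoly list) \<Rightarrow> real vec \<Rightarrow> bool"
where
  "kkt_point n s f g h x \<longleftrightarrow>
     x \<in> carrier_vec n \<and>
     (\<exists>\<mu> :: nat \<Rightarrow> real vec.
        (\<forall>i<s. \<mu> i \<in> carrier_vec (length (g i) + length (h i))) \<and>
        vsum n (\<lambda>i. gradient n (f i) x) {..<s} =
        vsum n (\<lambda>i. vsum n (\<lambda>j. (\<mu> i $ j) \<cdot>\<^sub>v gradient n (g i ! j) x) {..<length (g i)}
                   + vsum n (\<lambda>j. (\<mu> i $ (length (g i) + j)) \<cdot>\<^sub>v gradient n (h i ! j) x)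
                       {..<length (h i)}) {..<s} \<and>
        (\<forall>i<s. eval_tuple x (h i) = 0\<^sub>v (length (h i)) \<and>
           0\<^sub>v (length (g i)) \<le> vec_first (\<mu> i) (length (g i)) \<and>
           vec_first (\<mu> i) (length (g i)) \<bullet> eval_tuple x (g i) = 0 \<and>
           0\<^sub>v (length (g i)) \<le> eval_tuple x (g i)))"

section \<open>Clique-wise data\<close>

definition append_cols :: "'a :: zero mat \<Rightarrow> 'a mat \<Rightarrow> 'a mat" where
  "append_cols A B = four_block_mat A B (0\<^sub>m 0 (dim_col A)) (0\<^sub>m 0 (dim_col B))"

definition constraint_mat :: "nat list \<Rightarrow> rpoly list \<Rightarrow> rpoly mat" where
  "constraint_mat K c =
     mat_of_cols (length K) (map (clique_gradient K) c) @\<^sub>r mat_diag (length c) (\<lambda>j. c ! j)"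

text \<open>\<open>clique_unit K k\<close> is the standard basis vector at the position of \<open>k\<close> in \<open>K\<close>.\<close>

definition clique_unit :: "nat list \<Rightarrow> nat \<Rightarrow> real vec" where
  "clique_unit K k = vec (length K) (\<lambda>j. if K ! j = k then 1 else 0)"

text \<open>A family of auxiliary variables is a function \<open>\<nu>\<close> whose values \<open>\<nu> i t k\<close> are read only for
  \<open>(i, t) \<in> A\<close> and \<open>k \<in> \<C>\<^sub>i\<^sub>,\<^sub>t\<close>. The functions of \<open>z\<^sup>(\<^sup>i\<^sup>)\<close> below take all of \<open>x\<close> and \<open>\<nu>\<close> as arguments,
  but (for polynomial data in the variables of clique \<open>i\<close>) depend only on the part \<open>z\<^sup>(\<^sup>i\<^sup>)\<close>.\<close>

definition nu_vec ::
  "nat \<Rightarrow> (nat \<Rightarrow> nat list) \<Rightarrow> nat \<Rightarrow> (nat \<Rightarrow> nat \<Rightarrow> nat \<Rightarrow> real) \<Rightarrow> real vec"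
where
  "nu_vec s I i \<nu> = (let n\<^sub>i = length (I i) in
     - vsum n\<^sub>i (\<lambda>t. vsum n\<^sub>i (\<lambda>k. \<nu> i t k \<cdot>\<^sub>v clique_unit (I i) k) (clique_sep I i t))
         (clique_out s I i)
     + vsum n\<^sub>i (\<lambda>t. vsum n\<^sub>i (\<lambda>k. \<nu> t i k \<cdot>\<^sub>v clique_unit (I i) k) (clique_sep I t i))
         (clique_in s I i))"

definition F_vec ::
  "nat \<Rightarrow> (nat \<Rightarrow> nat list) \<Rightarrow> (nat \<Rightarrow> rpoly) \<Rightarrow> nat \<Rightarrow> real vec \<Rightarrow>
   (nat \<Rightarrow> nat \<Rightarrow> nat \<Rightarrow> real) \<Rightarrow> real vec"
where
  "F_vec s I f i x \<nu> = eval_vec x (clique_gradient (I i) (f i)) + nu_vec s I i \<nu>"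

definition p_vec ::
  "nat \<Rightarrow> (nat \<Rightarrow> nat list) \<Rightarrow> (nat \<Rightarrow> rpoly) \<Rightarrow> (nat \<Rightarrow> rpoly mat) \<Rightarrow> nat \<Rightarrow> real vec \<Rightarrow>
   (nat \<Rightarrow> nat \<Rightarrow> nat \<Rightarrow> real) \<Rightarrow> real vec"
where
  "p_vec s I f L i x \<nu> = eval_mat x (L i) *\<^sub>v F_vec s I f i x \<nu>"

end

theory Submission
  imports Defs
begin

text \<open>
  Fix a variable \<open>x\<^sub>k\<close> and a choice of multipliers. The stationarity residuals
  \<open>r\<^sub>i = \<partial>\<^sub>k f\<^sub>i - \<Sum>\<^sub>j \<mu>\<^sub>i\<^sub>j \<partial>\<^sub>k c\<^sub>i\<^sub>j\<close> live on the cliques that contain \<open>k\<close>, and by the running intersection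
  property these cliques form a subtree of the clique tree. The numbers \<open>\<nu>\<^sub>i\<^sub>,\<^sub>t\<^sub>,\<^sub>k\<close> are a flow along the
  arcs of this subtree, and on a tree a demand can be met by a flow if and only if it sums to zero.
  So the KKT equation splits into one equation \<open>F = \<Sum>\<^sub>j \<mu>\<^sub>j \<nabla>c\<^sub>j\<close> per clique. With complementarity this
  says \<open>G \<mu> = (F, 0)\<close>, and multiplying by the left inverse \<open>[L D]\<close> gives \<open>\<mu> = L F = p\<close>.
\<close>

section \<open>Evaluation of polynomials\<close>

lemma monom_eval_add: "monom_eval x (a + b) = monom_eval x a * monom_eval x b"
proof -
  let ?S = "Poly_Mapping.keys a \<union> Poly_Mapping.keys b"
  have "monom_eval x m = (\<Prod>k\<in>?S. (x $ k) ^ Poly_Mapping.lookup m k)" if "m \<in> {a, b, a + b}" for m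
    by (rule monom_eval_superset) (use that Poly_Mapping.keys_add[of a b] in auto)
  then show ?thesis
    by (simp add: lookup_add power_add prod.distrib)
qed

lemma poly_mapping_eq_sum_single:
  "p = (\<Sum>m\<in>Poly_Mapping.keys p. Poly_Mapping.single m (Poly_Mapping.lookup p m))"
  by (rule poly_mapping_eqI)
    (simp add: lookup_sum lookup_single when_def in_keys_iff)

text \<open>Expanding both factors into monomials leaves only products of single terms, where
  \<open>monom_eval_add\<close> applies. Together with additivity this makes evaluation a ring
  homomorphism, so the polynomial matrix identity for \<open>L\<close> and \<open>D\<close> can be
  evaluated at a point.\<close>

lemma peval_mult: "peval x (p * q) = peval x p * peval x q"
proof -
  have "peval x (p * q) = peval x
      ((\<Sum>a\<in>Poly_Mapping.keys p. Poly_Mapping.single a (Poly_Mapping.lookup p a)) *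
       (\<Sum>b\<in>Poly_Mapping.keys q. Poly_Mapping.single b (Poly_Mapping.lookup q b)))"
    by (simp only: poly_mapping_eq_sum_single[symmetric])
  also have "\<dots> = peval x p * peval x q"
    unfolding sum_product peval_sum mult_single peval_single monom_eval_add
    by (simp add: peval_def[of x p] peval_def[of x q] sum_product mult_ac)
  finally show ?thesis .
qed

lemma peval_one: "peval x 1 = 1"
  by (simp flip: single_one add: monom_eval_def)

lemma partial_deriv_eq_0:
  assumes "p \<in> polys_in V" "k \<notin> V"
  shows "partial_deriv k p = 0"
proof -
  have "Poly_Mapping.lookup m k = 0" if "m \<in> Poly_Mapping.keys p" for m
  proof -
    have "k \<notin> Poly_Mapping.keys m"
      using assms that unfolding polys_in_def poly_vars_def by blast
    then show ?thesis by (simp add: in_keys_iff)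
  qed
  then show ?thesis
    by (simp add: partial_deriv_def)
qed

section \<open>Flows on the clique tree\<close>

text \<open>The induction removes the largest node, which is a leaf because parents are smaller, and adds its
  demand to that of its parent. The root of the tree is \<open>Min K\<close>.\<close>

lemma tree_flow_exists:
  fixes K :: "nat set" and r :: "nat \<Rightarrow> real"
  assumes "finite K" "\<And>j. j \<in> K \<Longrightarrow> j \<noteq> Min K \<Longrightarrow> par j \<in> K \<and> par j < j" "sum r K = 0"
  shows "\<exists>\<phi>. \<forall>i\<in>K. (if i = Min K then 0 else \<phi> i) - (\<Sum>j | j \<in> K - {Min K} \<and> par j = i. \<phi> j) = r i"
  using assms
proof (induction K arbitrary: r rule: finite_linorder_max_induct)
  case empty
  then show ?case by simp
next
  case (insert b A)
  show ?case
  proof (cases "A = {}")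
    case True
    then show ?thesis using insert.prems by simp
  next
    case False
    have b: "b \<notin> A" and lt: "\<And>a. a \<in> A \<Longrightarrow> a < b" using insert.hyps by auto
    have Min_in: "Min A \<in> A" using False insert.hyps by simp
    \<comment> \<open>The root is not the removed node, so the tree on \<open>A\<close> has the same
      root and the same exceptional case.\<close>
    have Min: "Min (insert b A) = Min A"
      using False insert.hyps Min_in lt by (simp add: less_imp_le)
    have bM: "b \<noteq> Min A" using b Min_in by auto
    have par: "par j \<in> A \<and> par j < j" if "j \<in> insert b A" "j \<noteq> Min A" for j
      using insert.prems(1)[of j] that lt unfolding Min by fastforce
    have pb: "par b \<in> A" using par bM by blast
    let ?r = "r(par b := r (par b) + r b)"
    have "sum ?r A = sum r A + r b"
    proof -
      have "sum ?r A = ?r (par b) + sum ?r (A - {par b})"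
        using pb insert.hyps by (simp add: sum.remove)
      also have "sum ?r (A - {par b}) = sum r (A - {par b})"
        by (rule sum.cong) auto
      finally show ?thesis
        using pb insert.hyps by (simp add: sum.remove)
    qed
    then have "sum ?r A = 0"
      using insert.prems(2) b insert.hyps by simp
    then obtain \<phi> where \<phi>: "\<forall>i\<in>A. (if i = Min A then 0 else \<phi> i)
        - (\<Sum>j | j \<in> A - {Min A} \<and> par j = i. \<phi> j) = ?r i"
      using insert.IH[of ?r] par by blast
    \<comment> \<open>No arc enters the leaf \<open>b\<close>, so the arc leaving it must carry
      exactly its own demand \<open>r b\<close>.\<close>
    let ?\<psi> = "\<phi>(b := r b)"
    have "(if i = Min A then 0 else ?\<psi> i)
        - (\<Sum>j | j \<in> insert b A - {Min A} \<and> par j = i. ?\<psi> j) = r i" if i: "i \<in> insert b A" for i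
    proof (cases "i = b")
      case True
      have "par j \<noteq> b" if "j \<in> insert b A" "j \<noteq> Min A" for j
        using par[OF that] b by auto
      then have "{j. j \<in> insert b A - {Min A} \<and> par j = i} = {}"
        using True by auto
      then show ?thesis using True bM by (simp only: sum.empty) simp
    next
      case False
      with i have iA: "i \<in> A" by simp
      have fin: "finite {j. j \<in> A - {Min A} \<and> par j = i}" using insert.hyps by simp
      have eq: "(\<Sum>j | j \<in> A - {Min A} \<and> par j = i. ?\<psi> j) = (\<Sum>j | j \<in> A - {Min A} \<and> par j = i. \<phi> j)"
        by (rule sum.cong) (use b in auto)
      \<comment> \<open>Only the parent of \<open>b\<close> gains a child. The new term
        \<open>r b\<close> subtracted there cancels the demand that \<open>?r\<close> had
        added.\<close>
      have set: "{j. j \<in> insert b A - {Min A} \<and> par j = i} =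
          (if par b = i then insert b {j. j \<in> A - {Min A} \<and> par j = i}
           else {j. j \<in> A - {Min A} \<and> par j = i})"
        using bM by auto
      show ?thesis
        using \<phi>[rule_format, OF iA] False fin b eq unfolding set
        by (auto split: if_splits)
    qed
    then show ?thesis unfolding Min by blast
  qed
qed

text \<open>Each node except the root 0 is the tail of exactly one arc, so the arc set can be
  handled as a function of the tail. The value at 0 has no meaning, which is why the facts about
  arcs carry the guard \<open>0 < i\<close>.\<close>

definition clique_parent :: "(nat \<Rightarrow> nat list) \<Rightarrow> nat \<Rightarrow> nat" where
  "clique_parent I i = Max {t. t \<le> i - 1 \<and> run_inter I (i - 1) \<subseteq> set (I t)}"

lemma clique_arcs_iff:
  "(i, t) \<in> clique_arcs s I \<longleftrightarrow> 0 < i \<and> i < s \<and> t = clique_parent I i"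
  by (cases i) (auto simp: clique_arcs_def clique_parent_def)

text \<open>The running intersection property makes the set under \<open>Max\<close> nonempty, and a
  finite nonempty set contains its maximum. The index is shifted by one because
  \<open>run_inter I j\<close> belongs to clique \<open>Suc j\<close>.\<close>

lemma clique_parent:
  assumes "sparsity_pattern n s I" "0 < i" "i < s"
  shows "clique_parent I i < i" "run_inter I (i - 1) \<subseteq> set (I (clique_parent I i))"
proof -
  let ?T = "{t. t \<le> i - 1 \<and> run_inter I (i - 1) \<subseteq> set (I t)}"
  have "\<exists>t\<le>i - 1. run_inter I (i - 1) \<subseteq> set (I t)"
    using assms unfolding sparsity_pattern_def by (cases i) auto
  then have "Max ?T \<in> ?T"
    by (intro Max_in) auto
  then show "clique_parent I i < i" "run_inter I (i - 1) \<subseteq> set (I (clique_parent I i))"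
    using assms(2) unfolding clique_parent_def by auto
qed

text \<open>A variable already seen in an earlier clique lies in the running intersection, which the
  parent covers. Hence the cliques containing \<open>k\<close> are closed under taking parents,
  except at the first of them: they form a subtree.\<close>

lemma clique_parent_contains:
  assumes "sparsity_pattern n s I" "i < s" "k \<in> set (I i)" "j < i" "k \<in> set (I j)"
  shows "k \<in> set (I (clique_parent I i))"
proof -
  have "k \<in> run_inter I (i - 1)"
    using assms by (cases i) (auto simp: run_inter_def)
  then show ?thesis
    using clique_parent(2)[OF assms(1) _ assms(2)] assms(4) by auto
qed

lemma clique_out_eq:
  "i < s \<Longrightarrow> clique_out s I i = (if i = 0 then {} else {clique_parent I i})"
  by (auto simp: clique_out_def clique_arcs_iff)

lemma clique_in_eq: "clique_in s I i = {j. 0 < j \<and> j < s \<and> clique_parent I j = i}"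
  by (auto simp: clique_in_def clique_arcs_iff)

lemma finite_clique_in: "finite (clique_in s I i)"
  by (simp add: clique_in_eq)

lemma finite_clique_out: "finite (clique_out s I i)"
  by (rule finite_subset[of _ "{clique_parent I i}"]) (auto simp: clique_out_def clique_arcs_iff)

text \<open>This is the entry of \<open>nu_vec\<close> at variable \<open>k\<close>, read as a flow
  balance. For \<open>k\<close> in clique \<open>i\<close>, the test
  \<open>k \<in> set (I t)\<close> expresses membership in the separator of \<open>i\<close> and
  \<open>t\<close>.\<close>

definition net_inflow ::
  "nat \<Rightarrow> (nat \<Rightarrow> nat list) \<Rightarrow> (nat \<Rightarrow> nat \<Rightarrow> nat \<Rightarrow> real) \<Rightarrow> nat \<Rightarrow> nat \<Rightarrow> real"
where
  "net_inflow s I \<nu> i k =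
     (\<Sum>t\<in>clique_in s I i. if k \<in> set (I t) then \<nu> t i k else 0)
     - (\<Sum>t\<in>clique_out s I i. if k \<in> set (I t) then \<nu> i t k else 0)"

text \<open>Conservation: every arc between two cliques containing \<open>k\<close> is counted once
  as inflow at its head and once as outflow at its tail.\<close>

lemma net_inflow_sum_zero:
  assumes "sparsity_pattern n s I"
  shows "(\<Sum>i | i < s \<and> k \<in> set (I i). net_inflow s I \<nu> i k) = 0"
proof -
  let ?N = "{i. i < s \<and> k \<in> set (I i)}"
  \<comment> \<open>Extending the flow by zero to all pairs turns both parts of the balance into
    double sums over \<open>?N\<close>, which differ only by the order of summation.\<close>
  let ?a = "\<lambda>i t. if (i, t) \<in> clique_arcs s I then \<nu> i t k else 0"
  have fin: "finite ?N" by simp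
  have arcs: "i < s \<and> t < s" if "(i, t) \<in> clique_arcs s I" for i t
  proof -
    have it: "0 < i" "i < s" "t = clique_parent I i" using that by (simp_all add: clique_arcs_iff)
    then show ?thesis using clique_parent(1)[OF assms it(1,2)] by simp
  qed
  have "(\<Sum>t\<in>clique_in s I i. if k \<in> set (I t) then \<nu> t i k else 0) = (\<Sum>t\<in>?N. ?a t i)" for i
  proof -
    have "(\<Sum>t\<in>clique_in s I i. if k \<in> set (I t) then \<nu> t i k else 0)
        = (\<Sum>t | t \<in> clique_in s I i \<and> k \<in> set (I t). \<nu> t i k)"
      by (rule sum.inter_filter[symmetric]) (rule finite_clique_in)
    also have "{t \<in> clique_in s I i. k \<in> set (I t)} = {t \<in> ?N. (t, i) \<in> clique_arcs s I}"
      using arcs by (auto simp: clique_in_def)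
    also have "(\<Sum>t | t \<in> ?N \<and> (t, i) \<in> clique_arcs s I. \<nu> t i k) = (\<Sum>t\<in>?N. ?a t i)"
      by (rule sum.inter_filter) (rule fin)
    finally show ?thesis .
  qed
  moreover have "(\<Sum>t\<in>clique_out s I i. if k \<in> set (I t) then \<nu> i t k else 0) = (\<Sum>t\<in>?N. ?a i t)" for i
  proof -
    have "(\<Sum>t\<in>clique_out s I i. if k \<in> set (I t) then \<nu> i t k else 0)
        = (\<Sum>t | t \<in> clique_out s I i \<and> k \<in> set (I t). \<nu> i t k)"
      by (rule sum.inter_filter[symmetric]) (rule finite_clique_out)
    also have "{t \<in> clique_out s I i. k \<in> set (I t)} = {t \<in> ?N. (i, t) \<in> clique_arcs s I}"
      using arcs by (auto simp: clique_out_def)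
    also have "(\<Sum>t | t \<in> ?N \<and> (i, t) \<in> clique_arcs s I. \<nu> i t k) = (\<Sum>t\<in>?N. ?a i t)"
      by (rule sum.inter_filter) (rule fin)
    finally show ?thesis .
  qed
  ultimately have "(\<Sum>i\<in>?N. net_inflow s I \<nu> i k)
      = (\<Sum>i\<in>?N. \<Sum>t\<in>?N. ?a t i) - (\<Sum>i\<in>?N. \<Sum>t\<in>?N. ?a i t)"
    unfolding net_inflow_def by (simp only: sum_subtractf)
  also have "(\<Sum>i\<in>?N. \<Sum>t\<in>?N. ?a t i) = (\<Sum>i\<in>?N. \<Sum>t\<in>?N. ?a i t)"
    by (rule sum.swap)
  finally show ?thesis by (rule trans) (rule diff_self)
qed

text \<open>The variables do not interact: for each \<open>k\<close> the flow lemma is applied to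
  the subtree of cliques containing \<open>k\<close>, with demands \<open>r i k\<close>, and the
  resulting flows are collected by choice.\<close>

lemma net_inflow_exists:
  assumes pat: "sparsity_pattern n s I"
    and sum: "\<And>k. (\<Sum>i | i < s \<and> k \<in> set (I i). r i k) = 0"
  shows "\<exists>\<nu>. \<forall>i<s. \<forall>k\<in>set (I i). r i k + net_inflow s I \<nu> i k = 0"
proof -
  let ?K = "\<lambda>k. {i. i < s \<and> k \<in> set (I i)}"
  let ?par = "clique_parent I"
  have Min_le: "Min (?K k) \<le> i" if "i \<in> ?K k" for i k
    using that by (intro Min_le) auto
  have Min_in: "Min (?K k) \<in> ?K k" if "i \<in> ?K k" for i k
    using that by (intro Min_in) auto
  have par: "?par j \<in> ?K k \<and> ?par j < j" if j: "j \<in> ?K k" "j \<noteq> Min (?K k)" for j k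
  proof -
    have lt: "Min (?K k) < j" using Min_le[OF j(1)] j(2) by simp
    have "?par j < j" using clique_parent(1)[OF pat] lt j(1) by auto
    moreover have "k \<in> set (I (?par j))"
      using clique_parent_contains[OF pat _ _ lt] j(1) Min_in[OF j(1)] by auto
    ultimately show ?thesis using j(1) by auto
  qed
  have "\<exists>\<phi>. \<forall>i\<in>?K k. (if i = Min (?K k) then 0 else \<phi> i)
      - (\<Sum>j | j \<in> ?K k - {Min (?K k)} \<and> ?par j = i. \<phi> j) = r i k" for k
    by (rule tree_flow_exists) (use par sum in auto)
  then have "\<exists>\<phi>. \<forall>k. \<forall>i\<in>?K k. (if i = Min (?K k) then 0 else \<phi> k i)
      - (\<Sum>j | j \<in> ?K k - {Min (?K k)} \<and> ?par j = i. \<phi> k j) = r i k"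
    by (intro choice allI)
  then obtain \<phi> where \<phi>: "\<And>k i. i \<in> ?K k \<Longrightarrow> (if i = Min (?K k) then 0 else \<phi> k i)
      - (\<Sum>j | j \<in> ?K k - {Min (?K k)} \<and> ?par j = i. \<phi> k j) = r i k"
    by blast
  \<comment> \<open>The arc leaving the first clique that contains \<open>k\<close> ends in a clique
    without \<open>k\<close>, so it has no variable for \<open>k\<close>. This matches the outflow 0
    that \<open>tree_flow_exists\<close> prescribes at the root.\<close>
  have root: "k \<notin> set (I (?par j))" if "j = Min (?K k)" "0 < j" "j < s" for j k
  proof
    assume "k \<in> set (I (?par j))"
    moreover have "?par j < j" by (rule clique_parent(1)[OF pat that(2,3)])
    ultimately have "Min (?K k) \<le> ?par j" using that(3) by (intro Min_le) simp
    then show False using \<open>?par j < j\<close> that(1) by linarith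
  qed
  \<comment> \<open>An arc is determined by its tail, so the witness may ignore the head
    \<open>t\<close>.\<close>
  have "r i k + net_inflow s I (\<lambda>i t k. \<phi> k i) i k = 0" if i: "i < s" "k \<in> set (I i)" for i k
  proof -
    have iK: "i \<in> ?K k" using i by simp
    have "(\<Sum>t\<in>clique_in s I i. if k \<in> set (I t) then \<phi> k t else 0)
        = (\<Sum>j | j \<in> ?K k - {Min (?K k)} \<and> ?par j = i. \<phi> k j)"
    proof -
      have "j \<noteq> Min (?K k)" if "0 < j" "j < s" "?par j = i" for j
        using root[OF _ that(1,2)] that(3) i(2) by blast
      moreover have "0 < j" if "j \<in> ?K k" "j \<noteq> Min (?K k)" for j
        using Min_le[OF that(1)] that(2) by simp
      ultimately have "{t \<in> clique_in s I i. k \<in> set (I t)}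
          = {j. j \<in> ?K k - {Min (?K k)} \<and> ?par j = i}"
        unfolding clique_in_eq by blast
      then show ?thesis
        by (simp only: sum.inter_filter[OF finite_clique_in, symmetric])
    qed
    moreover have "(\<Sum>t\<in>clique_out s I i. if k \<in> set (I t) then \<phi> k i else 0)
        = (if i = Min (?K k) then 0 else \<phi> k i)"
    proof (cases "i = Min (?K k)")
      case True
      then show ?thesis using root[OF True _ i(1)] unfolding clique_out_eq[OF i(1)] by simp
    next
      case False
      then show ?thesis using par[OF iK False] unfolding clique_out_eq[OF i(1)] by auto
    qed
    ultimately show ?thesis
      using \<phi>[OF iK] unfolding net_inflow_def by simp
  qed
  then show ?thesis by blast
qed

section \<open>Coordinates of the auxiliary vectors\<close>

lemma nu_vec_carrier: "nu_vec s I i \<nu> \<in> carrier_vec (length (I i))"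
proof -
  let ?n = "length (I i)"
  have inner: "vsum ?n (\<lambda>k. w k \<cdot>\<^sub>v clique_unit (I i) k) S \<in> carrier_vec ?n" for w S
    by (intro finsum_vec_closed) (auto simp: clique_unit_def)
  have "vsum ?n (\<lambda>t. vsum ?n (\<lambda>k. w t k \<cdot>\<^sub>v clique_unit (I i) k) (S t)) T \<in> carrier_vec ?n"
    for w S and T :: "nat set"
    using inner by (intro finsum_vec_closed) auto
  then show ?thesis
    by (simp add: nu_vec_def Let_def)
qed

lemma nu_vec_index:
  assumes "distinct (I i)" "j < length (I i)"
  shows "nu_vec s I i \<nu> $ j = net_inflow s I \<nu> i (I i ! j)"
proof -
  let ?n = "length (I i)"
  have cu: "clique_unit (I i) k \<in> carrier_vec ?n" for k
    by (simp add: clique_unit_def)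
  have inner: "vsum ?n (\<lambda>k. w k \<cdot>\<^sub>v clique_unit (I i) k) S \<in> carrier_vec ?n" for w S
    using cu by (intro finsum_vec_closed) auto
  have outer: "vsum ?n (\<lambda>t. vsum ?n (\<lambda>k. w t k \<cdot>\<^sub>v clique_unit (I i) k) (S t)) T \<in> carrier_vec ?n"
    for w S and T :: "nat set"
    using inner by (intro finsum_vec_closed) auto
  \<comment> \<open>At coordinate \<open>j\<close> only the unit vector of the variable
    \<open>I i ! j\<close> is nonzero, so each inner sum collapses to at most one term.\<close>
  have idx: "vsum ?n (\<lambda>t. vsum ?n (\<lambda>k. w t k \<cdot>\<^sub>v clique_unit (I i) k) (S t)) T $ j
      = (\<Sum>t\<in>T. if I i ! j \<in> S t then w t (I i ! j) else 0)"
    if "finite T" "\<And>t. finite (S t)" for w S and T :: "nat set"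
  proof -
    have "vsum ?n (\<lambda>k. w t k \<cdot>\<^sub>v clique_unit (I i) k) (S t) $ j
        = (if I i ! j \<in> S t then w t (I i ! j) else 0)" for t
      using assms that(2) cu
      by (subst index_finsum_vec) (auto simp: clique_unit_def sum.delta if_distrib cong: if_cong)
    then show ?thesis
      using assms that(1) inner by (subst index_finsum_vec) auto
  qed
  have "dim_vec (vsum ?n (\<lambda>t. vsum ?n (\<lambda>k. w t k \<cdot>\<^sub>v clique_unit (I i) k) (S t)) T) = ?n"
    for w S and T :: "nat set"
    using outer carrier_vecD by blast
  moreover have "I i ! j \<in> set (I i)" using assms by simp
  moreover have "finite (clique_sep I a b)" for a b
    by (simp add: clique_sep_def)
  ultimately show ?thesis
    using assms
    by (simp add: nu_vec_def Let_def idx finite_clique_in finite_clique_out net_inflow_def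
        clique_sep_def cong: if_cong)
qed

section \<open>Stationarity, coordinate by coordinate\<close>

text \<open>One coordinate of the gradient of a clique's Lagrangian. The list \<open>c\<close> will
  be the concatenation of inequality and equality constraints, so that a single multiplier vector
  serves both.\<close>

definition residual :: "rpoly \<Rightarrow> rpoly list \<Rightarrow> real vec \<Rightarrow> real vec \<Rightarrow> nat \<Rightarrow> real" where
  "residual q c \<mu> x k =
     peval x (partial_deriv k q) - (\<Sum>j<length c. \<mu> $ j * peval x (partial_deriv k (c ! j)))"

lemma residual_eq_0:
  assumes "q \<in> polys_in V" "set c \<subseteq> polys_in V" "k \<notin> V"
  shows "residual q c \<mu> x k = 0"
proof -
  have "partial_deriv k (c ! j) = 0" if "j < length c" for j
    using partial_deriv_eq_0[OF _ assms(3)] assms(2) nth_mem[OF that] by blast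
  then show ?thesis
    by (simp add: residual_def partial_deriv_eq_0[OF assms(1,3)])
qed

text \<open>Accounts for the offset in the multipliers of the equality constraints. Induction from
  the right end of \<open>b\<close> is convenient because appending there leaves all earlier
  positions unchanged.\<close>

lemma sum_length_append:
  fixes w :: "nat \<Rightarrow> 'b \<Rightarrow> 'a :: comm_monoid_add"
  shows "(\<Sum>j<length (a @ b). w j ((a @ b) ! j)) =
     (\<Sum>j<length a. w j (a ! j)) + (\<Sum>j<length b. w (length a + j) (b ! j))"
proof (induction b rule: rev_induct)
  case Nil
  then show ?case by simp
next
  case (snoc y b)
  have "(\<Sum>j<length (a @ b). w j ((a @ b @ [y]) ! j)) = (\<Sum>j<length (a @ b). w j ((a @ b) ! j))"
    by (rule sum.cong) (auto simp: nth_append)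
  moreover have "(\<Sum>j<length b. w (length a + j) ((b @ [y]) ! j)) = (\<Sum>j<length b. w (length a + j) (b ! j))"
    by (rule sum.cong) (auto simp: nth_append)
  ultimately show ?case
    using snoc.IH by (simp add: nth_append add.assoc)
qed

lemma vsum_append_carrier:
  assumes "\<And>c. v c \<in> carrier_vec m"
  shows "vsum m (\<lambda>j. (\<mu> $ j) \<cdot>\<^sub>v v (a ! j)) {..<length a}
    + vsum m (\<lambda>j. (\<mu> $ (length a + j)) \<cdot>\<^sub>v v (b ! j)) {..<length b} \<in> carrier_vec m"
  using assms by (intro add_carrier_vec finsum_vec_closed) auto

text \<open>The vectors \<open>v\<close> are kept abstract so that the result covers both full
  gradients and clique gradients.\<close>

lemma vsum_append_index:
  fixes v :: "rpoly \<Rightarrow> real vec"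
  assumes v: "\<And>c. v c \<in> carrier_vec m" and i: "i < m"
  shows "(vsum m (\<lambda>j. (\<mu> $ j) \<cdot>\<^sub>v v (a ! j)) {..<length a}
    + vsum m (\<lambda>j. (\<mu> $ (length a + j)) \<cdot>\<^sub>v v (b ! j)) {..<length b}) $ i
    = (\<Sum>j<length (a @ b). \<mu> $ j * (v ((a @ b) ! j) $ i))"
proof -
  have dim: "dim_vec (v c) = m" for c
    using v by auto
  have cl: "vsum m (\<lambda>j. w j \<cdot>\<^sub>v v (c ! j)) S \<in> carrier_vec m" for w c and S :: "nat set"
    using v by (intro finsum_vec_closed) auto
  have idx: "vsum m (\<lambda>j. w j \<cdot>\<^sub>v v (c ! j)) {..<l} $ i = (\<Sum>j<l. w j * (v (c ! j) $ i))"
    for w c and l :: nat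
    using v i by (subst index_finsum_vec) (auto simp: dim)
  show ?thesis
    unfolding sum_length_append[of "\<lambda>j c. \<mu> $ j * (v c $ i)"]
    using carrier_vecD[OF cl] i by (simp add: idx)
qed

text \<open>Compared coordinatewise, global stationarity only asks that the residuals of all cliques
  cancel in total for each variable.\<close>

lemma kkt_equation_iff:
  fixes s :: nat
  shows "vsum n (\<lambda>i. gradient n (f i) x) {..<s} =
   vsum n (\<lambda>i. vsum n (\<lambda>j. (\<mu> i $ j) \<cdot>\<^sub>v gradient n (g i ! j) x) {..<length (g i)}
               + vsum n (\<lambda>j. (\<mu> i $ (length (g i) + j)) \<cdot>\<^sub>v gradient n (h i ! j) x)
                   {..<length (h i)}) {..<s}
   \<longleftrightarrow> (\<forall>k<n. (\<Sum>i<s. residual (f i) (g i @ h i) (\<mu> i) x k) = 0)"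
  (is "?l = ?r \<longleftrightarrow> _")
proof -
  have gr: "gradient n q x \<in> carrier_vec n" for q
    by (simp add: gradient_def)
  have l: "?l \<in> carrier_vec n"
    using gr by (intro finsum_vec_closed) auto
  have r: "?r \<in> carrier_vec n"
    using vsum_append_carrier[of "\<lambda>q. gradient n q x", OF gr] by (intro finsum_vec_closed) blast
  have lk: "?l $ k = (\<Sum>i<s. peval x (partial_deriv k (f i)))" if "k < n" for k
    using that gr by (subst index_finsum_vec) (auto simp: gradient_def)
  have rk: "?r $ k = (\<Sum>i<s. \<Sum>j<length (g i @ h i). \<mu> i $ j * peval x (partial_deriv k ((g i @ h i) ! j)))"
    if "k < n" for k
  proof -
    have "?r $ k = (\<Sum>i<s. (vsum n (\<lambda>j. (\<mu> i $ j) \<cdot>\<^sub>v gradient n (g i ! j) x) {..<length (g i)}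
               + vsum n (\<lambda>j. (\<mu> i $ (length (g i) + j)) \<cdot>\<^sub>v gradient n (h i ! j) x)
                   {..<length (h i)}) $ k)"
      using vsum_append_carrier[of "\<lambda>q. gradient n q x", OF gr] that
      by (intro index_finsum_vec finite_lessThan) blast+
    also have "\<dots> = (\<Sum>i<s. \<Sum>j<length (g i @ h i). \<mu> i $ j * (gradient n ((g i @ h i) ! j) x $ k))"
      by (intro sum.cong refl vsum_append_index[of "\<lambda>q. gradient n q x", OF gr that])
    finally show ?thesis
      using that by (simp add: gradient_def)
  qed
  have "?l = ?r \<longleftrightarrow> (\<forall>k<n. ?l $ k = ?r $ k)"
    using carrier_vecD[OF l] carrier_vecD[OF r] by (auto intro: eq_vecI)
  also have "\<dots> \<longleftrightarrow> (\<forall>k<n. (\<Sum>i<s. residual (f i) (g i @ h i) (\<mu> i) x k) = 0)"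
    by (simp add: lk rk residual_def sum_subtractf)
  finally show ?thesis .
qed

section \<open>The equation of a single clique\<close>

lemma F_vec_carrier: "F_vec s I f i x \<nu> \<in> carrier_vec (length (I i))"
  using nu_vec_carrier by (simp add: F_vec_def clique_gradient_def)

lemma F_vec_index:
  assumes "distinct (I i)" "j < length (I i)"
  shows "F_vec s I f i x \<nu> $ j
    = peval x (partial_deriv (I i ! j) (f i)) + net_inflow s I \<nu> i (I i ! j)"
  using assms carrier_vecD[OF nu_vec_carrier, of s I i \<nu>]
  by (simp add: F_vec_def clique_gradient_def nu_vec_index)

text \<open>The local counterpart of \<open>kkt_equation_iff\<close>: here the residual of each
  clique has to be balanced by its own net inflow. The multiplier vector is arbitrary, so
  \<open>p_vec\<close> can be substituted later.\<close>

lemma clique_equation_iff: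
  assumes "distinct (I i)"
  shows "F_vec s I f i x \<nu> =
      vsum (length (I i)) (\<lambda>j. (\<mu> $ j) \<cdot>\<^sub>v eval_vec x (clique_gradient (I i) (a ! j))) {..<length a}
      + vsum (length (I i)) (\<lambda>j. (\<mu> $ (length a + j)) \<cdot>\<^sub>v eval_vec x (clique_gradient (I i) (b ! j)))
          {..<length b}
    \<longleftrightarrow> (\<forall>k\<in>set (I i). residual (f i) (a @ b) \<mu> x k + net_inflow s I \<nu> i k = 0)"
  (is "?F = ?r \<longleftrightarrow> _")
proof -
  let ?v = "\<lambda>q. eval_vec x (clique_gradient (I i) q)"
  have v: "?v q \<in> carrier_vec (length (I i))" for q
    by (simp add: clique_gradient_def)
  have r: "?r \<in> carrier_vec (length (I i))"
    by (rule vsum_append_carrier[of ?v, OF v])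
  have "?F = ?r \<longleftrightarrow> (\<forall>j<length (I i). ?F $ j = ?r $ j)"
    using carrier_vecD[OF F_vec_carrier] carrier_vecD[OF r] by (auto intro: eq_vecI)
  also have "\<dots> \<longleftrightarrow> (\<forall>j<length (I i).
      residual (f i) (a @ b) \<mu> x (I i ! j) + net_inflow s I \<nu> i (I i ! j) = 0)"
  proof (intro all_cong1 imp_cong refl)
    fix j assume j: "j < length (I i)"
    have "?r $ j = (\<Sum>l<length (a @ b). \<mu> $ l * (?v ((a @ b) ! l) $ j))"
      by (rule vsum_append_index[of ?v, OF v j])
    also have "\<dots> = (\<Sum>l<length (a @ b). \<mu> $ l * peval x (partial_deriv (I i ! j) ((a @ b) ! l)))"
      using j by (simp add: clique_gradient_def)
    finally show "?F $ j = ?r $ j \<longleftrightarrow>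
        residual (f i) (a @ b) \<mu> x (I i ! j) + net_inflow s I \<nu> i (I i ! j) = 0"
      unfolding F_vec_index[where I = I and i = i, OF assms j] residual_def by linarith
  qed
  finally show ?thesis
    by (simp add: all_set_conv_all_nth)
qed

section \<open>Recovering the multipliers\<close>

text \<open>One entry of the matrix identity, evaluated at \<open>x\<close>. The upper block of
  \<open>constraint_mat\<close> gives the sum over the gradient; the lower block is diagonal, so a
  single entry of \<open>D\<close> survives.\<close>

lemma left_inverse_entry:
  assumes L: "L \<in> carrier_mat m (length K)" and D: "D \<in> carrier_mat m m"
    and m: "length c = m"
    and LD: "append_cols L D * constraint_mat K c = 1\<^sub>m m"
    and ab: "a < m" "b < m"
  shows "(\<Sum>j<length K. peval x (L $$ (a, j)) * peval x (partial_deriv (K ! j) (c ! b)))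
    + peval x (D $$ (a, b)) * peval x (c ! b) = (if a = b then 1 else 0)"
proof -
  let ?A = "append_cols L D" and ?G = "constraint_mat K c" and ?n = "length K"
  have A: "?A \<in> carrier_mat m (?n + m)"
    using L D by (auto simp: append_cols_def)
  have G: "?G \<in> carrier_mat (?n + m) m"
    unfolding constraint_mat_def using m
    by (intro carrier_append_rows) (metis length_map mat_of_cols_carrier(1), metis mat_diag_dim)
  have split: "(\<Sum>j<p + q. u j) = (\<Sum>j<p. u j) + (\<Sum>j<q. u (p + j))" for u :: "nat \<Rightarrow> rpoly" and p q
    by (induction q) (simp_all add: add.assoc)
  have A1: "?A $$ (a, j) = L $$ (a, j)" if "j < ?n" for j
    using L D ab that by (simp add: append_cols_def)
  have A2: "?A $$ (a, ?n + j) = D $$ (a, j)" if "j < m" for j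
    using L D ab that by (simp add: append_cols_def)
  have G1: "?G $$ (j, b) = partial_deriv (K ! j) (c ! b)" if "j < ?n" for j
    using m ab that
    by (simp add: constraint_mat_def append_rows_def mat_diag_def mat_of_cols_index clique_gradient_def)
  have G2: "?G $$ (?n + j, b) = (if j = b then c ! b else 0)" if "j < m" for j
    using m ab that by (simp add: constraint_mat_def append_rows_def mat_diag_def)
  have "(?A * ?G) $$ (a, b) = (\<Sum>j<?n + m. ?A $$ (a, j) * ?G $$ (j, b))"
    using A G ab by (auto simp: scalar_prod_def lessThan_atLeast0)
  also have "\<dots> = (\<Sum>j<?n. L $$ (a, j) * partial_deriv (K ! j) (c ! b)) + D $$ (a, b) * c ! b"
    using ab unfolding split
    by (simp add: A1 A2 G1 G2 if_distrib[of "(*) _"] sum.delta cong: if_cong)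
  finally have "peval x ((\<Sum>j<?n. L $$ (a, j) * partial_deriv (K ! j) (c ! b)) + D $$ (a, b) * c ! b)
      = peval x (if a = b then 1 else 0)"
    using LD ab by simp
  then show ?thesis
    by (simp add: peval_add peval_sum peval_mult peval_one if_distrib[of "peval x"] cong: if_cong)
qed

definition complementary :: "rpoly list \<Rightarrow> rpoly list \<Rightarrow> real vec \<Rightarrow> real vec \<Rightarrow> bool" where
  "complementary a b x \<mu> \<longleftrightarrow>
     0\<^sub>v (length a) \<le> vec_first \<mu> (length a) \<and>
     vec_first \<mu> (length a) \<bullet> eval_tuple x a = 0 \<and>
     0\<^sub>v (length a) \<le> eval_tuple x a \<and>
     eval_tuple x b = 0\<^sub>v (length b)"

text \<open>For an inequality, orthogonality says that a sum of nonnegative products vanishes, so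
  each product does. For an equality constraint the second factor is already zero.\<close>

lemma complementary_mult_eq_0:
  assumes "complementary a b x \<mu>" "l < length (a @ b)"
  shows "\<mu> $ l * peval x ((a @ b) ! l) = 0"
proof (cases "l < length a")
  case True
  have "(\<Sum>j<length a. \<mu> $ j * peval x (a ! j)) = 0"
    using assms(1) by (simp add: complementary_def scalar_prod_def eval_tuple_def vec_first_def
        lessThan_atLeast0)
  moreover have "0 \<le> \<mu> $ j * peval x (a ! j)" if "j < length a" for j
    using assms(1) that
    by (simp add: complementary_def less_eq_vec_def eval_tuple_def vec_first_def)
  ultimately have "\<forall>j\<in>{..<length a}. \<mu> $ j * peval x (a ! j) = 0"
    by (subst (asm) sum_nonneg_eq_0_iff) auto
  then show ?thesis
    using True by (auto simp: nth_append)
next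
  case False
  with assms(2) have l: "l - length a < length b" by auto
  have "eval_tuple x b $ (l - length a) = 0"
    using assms(1) l by (simp add: complementary_def)
  then show ?thesis
    using False l by (simp add: nth_append eval_tuple_def)
qed

text \<open>With J the matrix of constraint gradients, stationarity reads F = J \<mu>, and the left
  inverse gives L J = 1 - D diag(c). Hence L F = \<mu> - D diag(c) \<mu>, and diag(c) \<mu> = 0 by
  complementarity.\<close>

lemma multipliers_eq_p_vec:
  assumes L: "L i \<in> carrier_mat (length (a @ b)) (length (I i))"
    and D: "D \<in> carrier_mat (length (a @ b)) (length (a @ b))"
    and LD: "append_cols (L i) D * constraint_mat (I i) (a @ b) = 1\<^sub>m (length (a @ b))"
    and dist: "distinct (I i)"
    and \<mu>: "\<mu> \<in> carrier_vec (length (a @ b))"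
    and comp: "complementary a b x \<mu>"
    and stat: "\<And>k. k \<in> set (I i) \<Longrightarrow> residual (f i) (a @ b) \<mu> x k + net_inflow s I \<nu> i k = 0"
  shows "p_vec s I f L i x \<nu> = \<mu>"
proof (rule eq_vecI)
  let ?c = "a @ b" and ?n = "length (I i)"
  let ?L = "\<lambda>l j. peval x (L i $$ (l, j))"
  show "dim_vec (p_vec s I f L i x \<nu>) = dim_vec \<mu>"
    using L \<mu> by (simp add: p_vec_def)
  fix l assume "l < dim_vec \<mu>"
  with \<mu> have l: "l < length ?c" by simp
  have F: "F_vec s I f i x \<nu> $ j
      = (\<Sum>q<length ?c. \<mu> $ q * peval x (partial_deriv (I i ! j) (?c ! q)))" if "j < ?n" for j
    using stat[of "I i ! j"] that by (simp add: F_vec_index[where I = I and i = i, OF dist] residual_def)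
  have inv: "(\<Sum>j<?n. ?L l j * peval x (partial_deriv (I i ! j) (?c ! q)))
      = (if l = q then 1 else 0) - peval x (D $$ (l, q)) * peval x (?c ! q)" if "q < length ?c" for q
    using left_inverse_entry[OF L D refl LD l that, of x] by linarith
  have "p_vec s I f L i x \<nu> $ l = (\<Sum>j<?n. ?L l j * F_vec s I f i x \<nu> $ j)"
    using L l carrier_vecD[OF F_vec_carrier, of s I f i x \<nu>]
    by (simp add: p_vec_def scalar_prod_def lessThan_atLeast0)
  also have "\<dots> = (\<Sum>j<?n. \<Sum>q<length ?c. \<mu> $ q * (?L l j * peval x (partial_deriv (I i ! j) (?c ! q))))"
    by (rule sum.cong) (simp_all add: F sum_distrib_left mult_ac)
  also have "\<dots> = (\<Sum>q<length ?c. \<mu> $ q * (\<Sum>j<?n. ?L l j * peval x (partial_deriv (I i ! j) (?c ! q))))"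
    unfolding sum_distrib_left by (rule sum.swap)
  also have "\<dots> = (\<Sum>q<length ?c. if l = q then \<mu> $ q else 0)"
  proof (rule sum.cong)
    fix q assume "q \<in> {..<length ?c}"
    then have q: "q < length ?c" by simp
    \<comment> \<open>Regrouped so that the product of multiplier and constraint value appears as a
      factor and can be replaced by zero.\<close>
    have "\<mu> $ q * ((if l = q then 1 else 0) - peval x (D $$ (l, q)) * peval x (?c ! q))
        = (if l = q then \<mu> $ q else 0) - peval x (D $$ (l, q)) * (\<mu> $ q * peval x (?c ! q))"
      by (simp add: algebra_simps)
    then show "\<mu> $ q * (\<Sum>j<?n. ?L l j * peval x (partial_deriv (I i ! j) (?c ! q)))
        = (if l = q then \<mu> $ q else 0)"
      unfolding inv[OF q] complementary_mult_eq_0[OF comp q] by simp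
  qed simp
  also have "\<dots> = \<mu> $ l"
    using l by simp
  finally show "p_vec s I f L i x \<nu> $ l = \<mu> $ l" .
qed

section \<open>Equivalence of the global and the clique-wise KKT systems\<close>

theorem theorem3p10:
  fixes n s :: nat
    and I :: "nat \<Rightarrow> nat list"
    and f :: "nat \<Rightarrow> rpoly"
    and g h :: "nat \<Rightarrow> rpoly list"
    and L D :: "nat \<Rightarrow> rpoly mat"
    and x :: "real vec"
  assumes pattern: "sparsity_pattern n s I"
    and f: "\<And>i. i < s \<Longrightarrow> f i \<in> polys_in (set (I i))"
    and g: "\<And>i. i < s \<Longrightarrow> set (g i) \<subseteq> polys_in (set (I i))"
    and h: "\<And>i. i < s \<Longrightarrow> set (h i) \<subseteq> polys_in (set (I i))"
    and L: "\<And>i. i < s \<Longrightarrow> L i \<in> carrier_mat (length (g i) + length (h i)) (length (I i))"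
           "\<And>i. i < s \<Longrightarrow> elements_mat (L i) \<subseteq> polys_in (set (I i))"
    and D: "\<And>i. i < s \<Longrightarrow>
              D i \<in> carrier_mat (length (g i) + length (h i)) (length (g i) + length (h i))"
           "\<And>i. i < s \<Longrightarrow> elements_mat (D i) \<subseteq> polys_in (set (I i))"
    and LD: "\<And>i. i < s \<Longrightarrow>
               append_cols (L i) (D i) * constraint_mat (I i) (g i @ h i)
                 = 1\<^sub>m (length (g i) + length (h i))"
    and x: "x \<in> carrier_vec n"
  shows "kkt_point n s f g h x \<longleftrightarrow>
    (\<exists>\<nu> :: nat \<Rightarrow> nat \<Rightarrow> nat \<Rightarrow> real. \<forall>i<s.
       F_vec s I f i x \<nu> =
         vsum (length (I i))
           (\<lambda>j. (p_vec s I f L i x \<nu> $ j) \<cdot>\<^sub>v eval_vec x (clique_gradient (I i) (g i ! j)))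
           {..<length (g i)}
         + vsum (length (I i))
           (\<lambda>j. (p_vec s I f L i x \<nu> $ (length (g i) + j)) \<cdot>\<^sub>v
                  eval_vec x (clique_gradient (I i) (h i ! j)))
           {..<length (h i)} \<and>
       0\<^sub>v (length (g i)) \<le> vec_first (p_vec s I f L i x \<nu>) (length (g i)) \<and>
       vec_first (p_vec s I f L i x \<nu>) (length (g i)) \<bullet> eval_tuple x (g i) = 0 \<and>
       0\<^sub>v (length (g i)) \<le> eval_tuple x (g i) \<and>
       eval_tuple x (h i) = 0\<^sub>v (length (h i)))"
proof -
  let ?c = "\<lambda>i. g i @ h i"
  let ?p = "p_vec s I f L"
  have dist: "distinct (I i)" if "i < s" for i
    using pattern that by (simp add: sparsity_pattern_def)
  have vars: "set (I i) \<subseteq> {..<n}" if "i < s" for i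
    using pattern that unfolding sparsity_pattern_def by blast
  have kkt: "kkt_point n s f g h x \<longleftrightarrow> (\<exists>\<mu>. (\<forall>i<s. \<mu> i \<in> carrier_vec (length (?c i))) \<and>
      (\<forall>k<n. (\<Sum>i<s. residual (f i) (?c i) (\<mu> i) x k) = 0) \<and>
      (\<forall>i<s. complementary (g i) (h i) x (\<mu> i)))"
    using x unfolding kkt_point_def kkt_equation_iff complementary_def by auto
  \<comment> \<open>A clique's polynomials do not involve variables outside it, so the other cliques
    contribute zero. The sum now runs over the subtree on which the flow lives.\<close>
  have local_sum: "(\<Sum>i<s. residual (f i) (?c i) (\<mu> i) x k)
      = (\<Sum>i | i < s \<and> k \<in> set (I i). residual (f i) (?c i) (\<mu> i) x k)" for \<mu> k
  proof (rule sum.mono_neutral_right)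
    show "\<forall>i\<in>{..<s} - {i. i < s \<and> k \<in> set (I i)}. residual (f i) (?c i) (\<mu> i) x k = 0"
    proof
      fix i assume "i \<in> {..<s} - {i. i < s \<and> k \<in> set (I i)}"
      then have "i < s" "k \<notin> set (I i)" by auto
      then show "residual (f i) (?c i) (\<mu> i) x k = 0"
        using f g h by (intro residual_eq_0[of _ "set (I i)"]) auto
    qed
  qed auto
  \<comment> \<open>The clique-wise system in flow form, with \<open>p_vec\<close> in the role of
    the multipliers.\<close>
  have "kkt_point n s f g h x \<longleftrightarrow> (\<exists>\<nu>. \<forall>i<s.
      (\<forall>k\<in>set (I i). residual (f i) (?c i) (?p i x \<nu>) x k + net_inflow s I \<nu> i k = 0) \<and>
      complementary (g i) (h i) x (?p i x \<nu>))"
  proof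
    assume "kkt_point n s f g h x"
    then obtain \<mu> where \<mu>: "\<And>i. i < s \<Longrightarrow> \<mu> i \<in> carrier_vec (length (?c i))"
        "\<And>k. k < n \<Longrightarrow> (\<Sum>i<s. residual (f i) (?c i) (\<mu> i) x k) = 0"
        "\<And>i. i < s \<Longrightarrow> complementary (g i) (h i) x (\<mu> i)"
      unfolding kkt by blast
    \<comment> \<open>\<open>net_inflow_exists\<close> asks for balanced demands at every natural
      number \<open>k\<close>; for \<open>k\<close> at least \<open>n\<close> no clique contains
      \<open>k\<close> and the sum is empty.\<close>
    have "(\<Sum>i | i < s \<and> k \<in> set (I i). residual (f i) (?c i) (\<mu> i) x k) = 0" for k
    proof (cases "k < n")
      case True
      then show ?thesis using \<mu>(2) unfolding local_sum by blast
    next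
      case False
      then have "{i. i < s \<and> k \<in> set (I i)} = {}" using vars by blast
      then show ?thesis by (simp only: sum.empty)
    qed
    then obtain \<nu> where \<nu>: "\<forall>i<s. \<forall>k\<in>set (I i).
        residual (f i) (?c i) (\<mu> i) x k + net_inflow s I \<nu> i k = 0"
      using net_inflow_exists[OF pattern, of "\<lambda>i. residual (f i) (?c i) (\<mu> i) x"] by blast
    \<comment> \<open>The flow was built for the given multipliers, and the left inverse forces them
      to agree with \<open>p_vec\<close>.\<close>
    have "?p i x \<nu> = \<mu> i" if "i < s" for i
      using L(1)[OF that] D(1)[OF that] LD[OF that] dist[OF that] \<mu>(1,3)[OF that] \<nu> that
      by (intro multipliers_eq_p_vec[where D = "D i"]) auto
    then show "\<exists>\<nu>. \<forall>i<s.
      (\<forall>k\<in>set (I i). residual (f i) (?c i) (?p i x \<nu>) x k + net_inflow s I \<nu> i k = 0) \<and>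
      complementary (g i) (h i) x (?p i x \<nu>)"
      using \<nu> \<mu>(3) by (intro exI[of _ \<nu>]) simp
  next
    assume "\<exists>\<nu>. \<forall>i<s.
      (\<forall>k\<in>set (I i). residual (f i) (?c i) (?p i x \<nu>) x k + net_inflow s I \<nu> i k = 0) \<and>
      complementary (g i) (h i) x (?p i x \<nu>)"
    then obtain \<nu> where \<nu>: "\<forall>i<s.
      (\<forall>k\<in>set (I i). residual (f i) (?c i) (?p i x \<nu>) x k + net_inflow s I \<nu> i k = 0) \<and>
      complementary (g i) (h i) x (?p i x \<nu>)" ..
    have stat: "residual (f i) (?c i) (?p i x \<nu>) x k + net_inflow s I \<nu> i k = 0"
      if "i < s" "k \<in> set (I i)" for i k
      using \<nu> that by simp
    have comp: "complementary (g i) (h i) x (?p i x \<nu>)" if "i < s" for i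
      using \<nu> that by simp
    have "?p i x \<nu> \<in> carrier_vec (length (?c i))" if "i < s" for i
    proof -
      have "eval_mat x (L i) \<in> carrier_mat (length (?c i)) (length (I i))"
        using L(1)[OF that] by simp
      then show ?thesis
        unfolding p_vec_def by (rule mult_mat_vec_carrier) (rule F_vec_carrier)
    qed
    \<comment> \<open>Summing the local equations eliminates the auxiliary variables by
      conservation, so \<open>p_vec\<close> itself supplies the KKT multipliers.\<close>
    moreover have "(\<Sum>i<s. residual (f i) (?c i) (?p i x \<nu>) x k) = 0" for k
    proof -
      have "(\<Sum>i<s. residual (f i) (?c i) (?p i x \<nu>) x k)
          = (\<Sum>i | i < s \<and> k \<in> set (I i). - net_inflow s I \<nu> i k)"
        unfolding local_sum by (rule sum.cong) (use stat in \<open>auto simp: eq_neg_iff_add_eq_0\<close>)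
      also have "\<dots> = 0"
        by (simp only: sum_negf net_inflow_sum_zero[OF pattern] minus_zero)
      finally show ?thesis .
    qed
    ultimately show "kkt_point n s f g h x"
      unfolding kkt using comp by (intro exI[of _ "\<lambda>i. ?p i x \<nu>"]) simp
  qed
  then show ?thesis
    using dist by (simp add: clique_equation_iff complementary_def cong: conj_cong)
qed

end
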